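(* The topological space $(\mathbb{H},\tau_s)$ is Hausdorff, and $\tau\subsetneq\tau_s$, where $\tau_s$ is the slice topology and $\tau$ is the Euclidean topology on the quaternions $\mathbb{H}$.
   Context: $\mathbb{S}=\{q\in\mathbb{H}: q^2=-1\}$ and $\mathbb{C}_I=\mathbb{R}+I\mathbb{R}$ for $I\in\mathbb{S}$. A set $\Omega\subset\mathbb{H}$ is slice-open if $\Omega\cap\mathbb{C}_I$ is open in $\mathbb{C}_I$ (Euclidean topology) for every $I\in\mathbb{S}$; the slice topology $\tau_s$ is the topology on $\mathbb{H}$ consisting of all slice-open sets. *)

theory Defs
  imports "HOL-Analysis.Analysis"
begin

codatatype quat = Quat (qRe: real) (qIm1: real) (qIm2: real) (qIm3: real)

lemma quat_eqI:
  "\<lbrakk>qRe p = qRe q; qIm1 p = qIm1 q; qIm2 p = qIm2 q; qIm3 p = qIm3 q\<rbrakk> \<Longrightarrow> p = q"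
  by (rule quat.expand) simp

lemma quat_eq_iff:
  "p = q \<longleftrightarrow> qRe p = qRe q \<and> qIm1 p = qIm1 q \<and> qIm2 p = qIm2 q \<and> qIm3 p = qIm3 q"
  by (auto intro: quat_eqI)

instantiation quat :: ab_group_add
begin

primcorec zero_quat where
  "qRe 0 = 0" | "qIm1 0 = 0" | "qIm2 0 = 0" | "qIm3 0 = 0"

primcorec plus_quat where
  "qRe (p + q) = qRe p + qRe q"
| "qIm1 (p + q) = qIm1 p + qIm1 q"
| "qIm2 (p + q) = qIm2 p + qIm2 q"
| "qIm3 (p + q) = qIm3 p + qIm3 q"

primcorec uminus_quat where
  "qRe (- p) = - qRe p"
| "qIm1 (- p) = - qIm1 p"
| "qIm2 (- p) = - qIm2 p"
| "qIm3 (- p) = - qIm3 p"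

primcorec minus_quat where
  "qRe (p - q) = qRe p - qRe q"
| "qIm1 (p - q) = qIm1 p - qIm1 q"
| "qIm2 (p - q) = qIm2 p - qIm2 q"
| "qIm3 (p - q) = qIm3 p - qIm3 q"

instance
  by standard (simp_all add: quat_eq_iff)

end

text \<open>Hamilton multiplication with \<open>i\<^sup>2 = j\<^sup>2 = k\<^sup>2 = ijk = -1\<close>.\<close>

instantiation quat :: ring_1
begin

primcorec one_quat where
  "qRe 1 = 1" | "qIm1 1 = 0" | "qIm2 1 = 0" | "qIm3 1 = 0"

primcorec times_quat where
  "qRe (p * q) = qRe p * qRe q - qIm1 p * qIm1 q - qIm2 p * qIm2 q - qIm3 p * qIm3 q"
| "qIm1 (p * q) = qRe p * qIm1 q + qIm1 p * qRe q + qIm2 p * qIm3 q - qIm3 p * qIm2 q"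
| "qIm2 (p * q) = qRe p * qIm2 q - qIm1 p * qIm3 q + qIm2 p * qRe q + qIm3 p * qIm1 q"
| "qIm3 (p * q) = qRe p * qIm3 q + qIm1 p * qIm2 q - qIm2 p * qIm1 q + qIm3 p * qRe q"

instance
  by standard (simp_all add: quat_eq_iff algebra_simps)

end

instantiation quat :: real_algebra_1
begin

primcorec scaleR_quat where
  "qRe (r *\<^sub>R p) = r * qRe p"
| "qIm1 (r *\<^sub>R p) = r * qIm1 p"
| "qIm2 (r *\<^sub>R p) = r * qIm2 p"
| "qIm3 (r *\<^sub>R p) = r * qIm3 p"

instance
  by standard (simp_all add: quat_eq_iff algebra_simps)

end

text \<open>The inner product of \<open>\<real>\<^sup>4\<close>; \<^const>\<open>open\<close> on \<^typ>\<open>quat\<close> is thereby the Euclidean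
  topology \<open>\<tau>\<close>.\<close>

instantiation quat :: real_inner
begin

definition inner_quat :: "quat \<Rightarrow> quat \<Rightarrow> real" where
  "inner_quat p q = qRe p * qRe q + qIm1 p * qIm1 q + qIm2 p * qIm2 q + qIm3 p * qIm3 q"

definition norm_quat :: "quat \<Rightarrow> real" where
  "norm_quat p = sqrt (inner p p)"

definition sgn_quat :: "quat \<Rightarrow> quat" where
  "sgn_quat p = p /\<^sub>R norm p"

definition dist_quat :: "quat \<Rightarrow> quat \<Rightarrow> real" where
  "dist_quat p q = norm (p - q)"

definition uniformity_quat :: "(quat \<times> quat) filter" where
  "uniformity_quat = (INF e\<in>{0 <..}. principal {(p, q). dist p q < e})"

definition open_quat :: "quat set \<Rightarrow> bool" where
  "open_quat U \<longleftrightarrow> (\<forall>p\<in>U. eventually (\<lambda>(p', q). p' = p \<longrightarrow> q \<in> U) uniformity)"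

instance
proof
  fix p q s :: quat and r :: real
  show "0 \<le> inner p p"
    by (simp add: inner_quat_def)
  show "inner p p = 0 \<longleftrightarrow> p = 0"
    unfolding inner_quat_def quat_eq_iff
    by (simp add: add_nonneg_eq_0_iff flip: power2_eq_square)
qed (auto simp: inner_quat_def norm_quat_def sgn_quat_def dist_quat_def
      uniformity_quat_def open_quat_def algebra_simps)

end

definition imaginary_units :: "quat set" where
  "imaginary_units = {q. q\<^sup>2 = - 1}"

definition slice :: "quat \<Rightarrow> quat set" where
  "slice I = {of_real x + I * of_real y | x y. True}"

definition slice_open :: "quat set \<Rightarrow> bool" where
  "slice_open U \<longleftrightarrow> (\<forall>I\<in>imaginary_units. openin (top_of_set (slice I)) (U \<inter> slice I))"

definition slice_topology :: "quat topology" where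
  "slice_topology = topology slice_open"

lemma istopology_slice_open: "istopology slice_open"
  unfolding istopology_def
proof (intro conjI allI impI)
  fix U V assume "slice_open U" "slice_open V"
  moreover have "U \<inter> V \<inter> slice I = (U \<inter> slice I) \<inter> (V \<inter> slice I)" for I
    by blast
  ultimately show "slice_open (U \<inter> V)"
    by (auto simp: slice_open_def intro: openin_Int)
next
  fix \<U> assume \<U>: "\<forall>U\<in>\<U>. slice_open U"
  have "openin (top_of_set (slice I)) (\<Union>\<U> \<inter> slice I)" if "I \<in> imaginary_units" for I
  proof -
    have "openin (top_of_set (slice I)) (\<Union>U\<in>\<U>. U \<inter> slice I)"
      using \<U> that by (intro openin_Union) (auto simp: slice_open_def)
    also have "(\<Union>U\<in>\<U>. U \<inter> slice I) = \<Union>\<U> \<inter> slice I"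
      by blast
    finally show ?thesis .
  qed
  then show "slice_open (\<Union>\<U>)"
    by (simp add: slice_open_def)
qed

lemma openin_slice_topology [simp]: "openin slice_topology U \<longleftrightarrow> slice_open U"
  by (simp add: slice_topology_def istopology_slice_open)

lemma topspace_slice_topology [simp]: "topspace slice_topology = UNIV"
proof -
  have "slice_open UNIV"
    by (simp add: slice_open_def)
  then show ?thesis
    by (metis openin_slice_topology openin_subset top.extremum_uniqueI)
qed

end

theory Submission
  imports Defs
begin

text \<open>Euclidean open sets are slice-open, so the slice topology inherits the Hausdorff property.
  Strictness comes from the arc of all \<open>t i + t\<^sup>2 j\<close> with \<open>t > 0\<close>: elements of one slice commute, but
  distinct points of the arc do not, so every slice meets the arc in at most one point. The
  complement of the arc is therefore slice-open, yet the arc accumulates at \<open>0\<close>, which is not on it.\<close>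

lemma open_imp_slice_open: "open U \<Longrightarrow> slice_open U"
  by (auto simp: slice_open_def openin_open)

lemma Hausdorff_slice_topology: "Hausdorff_space slice_topology"
  unfolding Hausdorff_space_def
proof (intro allI impI)
  fix p q assume "p \<in> topspace slice_topology \<and> q \<in> topspace slice_topology \<and> p \<noteq> q"
  then obtain U V where "open U" "open V" "p \<in> U" "q \<in> V" "U \<inter> V = {}"
    by (meson hausdorff)
  then show "\<exists>U V. openin slice_topology U \<and> openin slice_topology V \<and>
      p \<in> U \<and> q \<in> V \<and> disjnt U V"
    by (auto simp: disjnt_def intro: open_imp_slice_open)
qed

text \<open>Both points are real polynomials in the same \<open>I\<close>, and real scalars are
  central.\<close>

lemma slice_commute:
  assumes "p \<in> slice I" "q \<in> slice I"
  shows "p * q = q * p"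
proof -
  obtain a b c d where "p = of_real a + I * of_real b" "q = of_real c + I * of_real d"
    using assms by (auto simp: slice_def)
  then show ?thesis
    by (simp add: of_real_def algebra_simps)
qed

lemma slice_open_Compl_noncommuting:
  assumes "\<And>p q. p \<in> A \<Longrightarrow> q \<in> A \<Longrightarrow> p * q = q * p \<Longrightarrow> p = q"
  shows "slice_open (- A)"
  unfolding slice_open_def
proof
  fix I
  \<comment> \<open>Points of \<open>A\<close> in one slice commute, hence coincide; if there are
    none, any \<open>a\<close> serves.\<close>
  have "\<exists>a. A \<inter> slice I \<subseteq> {a}"
    using assms slice_commute by blast
  then have "closed (A \<inter> slice I)"
    by (meson finite.emptyI finite_imp_closed finite_insert finite_subset)
  moreover have "- A \<inter> slice I = slice I \<inter> - (A \<inter> slice I)"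
    by blast
  ultimately show "openin (top_of_set (slice I)) (- A \<inter> slice I)"
    by (metis open_Compl openin_open_Int)
qed

text \<open>The ray from 0 through the point at t > 0 has slope t, so distinct points have
  non-parallel imaginary parts.\<close>

definition parabola :: "real \<Rightarrow> quat" where
  "parabola t = Quat 0 t (t\<^sup>2) 0"

lemma parabola_commute_imp_eq:
  assumes "s > 0" "t > 0" "parabola s * parabola t = parabola t * parabola s"
  shows "s = t"
proof -
  \<comment> \<open>The k-component of a product of two points of the i-j plane is the determinant
    of their coordinates, so it changes sign when the factors are swapped.\<close>
  have "s * t\<^sup>2 - s\<^sup>2 * t = t * s\<^sup>2 - t\<^sup>2 * s"
    using arg_cong[OF assms(3), of qIm3] by (simp add: parabola_def mult.commute)
  then have "s * t * (t - s) = 0"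
    by algebra
  then show ?thesis
    using assms by simp
qed

lemma parabola_tendsto_0: "(parabola \<longlongrightarrow> 0) (at_right 0)"
proof -
  \<comment> \<open>As a combination of fixed vectors, the curve is open to the limit rules for sums
    and scalings.\<close>
  have "parabola = (\<lambda>t. t *\<^sub>R Quat 0 1 0 0 + t\<^sup>2 *\<^sub>R Quat 0 0 1 0)"
    by (simp add: fun_eq_iff quat_eq_iff parabola_def)
  moreover have "((\<lambda>t. t *\<^sub>R Quat 0 1 0 0 + t\<^sup>2 *\<^sub>R Quat 0 0 1 0) \<longlongrightarrow> 0) (at_right 0)"
    by (auto intro!: tendsto_eq_intros)
  ultimately show ?thesis
    by simp
qed

lemma slice_open_not_open: "\<exists>U. slice_open U \<and> \<not> open U"
proof (intro exI conjI)
  let ?U = "- parabola ` {0<..}"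
  show "slice_open ?U"
    by (rule slice_open_Compl_noncommuting) (auto dest: parabola_commute_imp_eq)
  show "\<not> open ?U"
  proof
    assume "open ?U"
    moreover have "0 \<in> ?U"
      by (auto simp: parabola_def quat_eq_iff)
    ultimately have "\<forall>\<^sub>F t in at_right 0. parabola t \<in> ?U"
      using parabola_tendsto_0 topological_tendstoD by blast
    moreover have "\<forall>\<^sub>F t in at_right 0. parabola t \<notin> ?U"
      using eventually_at_right_less[of 0] by eventually_elim auto
    ultimately have "\<forall>\<^sub>F t in at_right (0::real). False"
      by eventually_elim auto
    \<comment> \<open>The filter \<open>at_right 0\<close> is nontrivial, so \<open>False\<close>
      cannot hold eventually.\<close>
    then show False
      by simp
  qed
qed

theorem proposition3p1:
  shows "Hausdorff_space slice_topology \<and>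
    {U :: quat set. openin euclidean U} \<subset> {U. openin slice_topology U}"
  using Hausdorff_slice_topology open_imp_slice_open slice_open_not_open
  by (auto simp: psubset_eq set_eq_iff)

end
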